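(* Let $\mathbb{K}$ be a field, let $G$ be a connected simple graph on $[n]$ with $n\ge 2$, let $2\le m_1\leq m_2$ be integers, and let $T$ be a cut set of $G$. Then $$\mathrm{v}_T(J_{K_{m_2},G})\leq \mathrm{v}_T(J_{K_{m_1},G}).$$ In particular, $\mathrm{v}_T(J_G)\geq \mathrm{v}_T(J_{K_3,G})\geq \mathrm{v}_T(J_{K_4,G})\geq\cdots$, which implies $$\mathrm{v}(J_G)\geq \mathrm{v}(J_{K_3,G})\geq \mathrm{v}(J_{K_4,G})\geq\cdots.$$
   Context: $[n]=\{1,\dots,n\}$. For $m\ge 2$, the generalized binomial edge ideal of $(K_m,G)$ is $$J_{K_m,G}=(x_{i,k}x_{j,\ell}-x_{i,\ell}x_{j,k}: i,j\in[m],\ \{k,\ell\}\in E(G))\subset \mathbb{K}[x_{i,j}:i\in[m],j\in[n]],$$ where the polynomial ring has the standard grading. For $m=2$ it is the binomial edge ideal, $J_G:=J_{K_2,G}$. For $T\subseteq[n]$, let $G_1,\dots,G_{c(T)}$ be the connected components of the induced subgraph of $G$ on $[n]\setminus T$, and let $\widetilde G_i$ be the complete graph on the vertices of $G_i$. Define $$P_T(K_m,G)=(x_{i,j}: i\in[m], j\in T)+J_{K_m,\widetilde G_1}+\cdots+J_{K_m,\widetilde G_{c(T)}}.$$ $T$ is a cut set of $G$ if $T=\emptyset$ or $c(T\setminus\{t\})<c(T)$ for every $t\in T$. The ideal $J_{K_m,G}$ is radical and its minimal primes are the $P_T(K_m,G)$ with $T$ a cut set of $G$. For a graded ideal $I$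 in a standard graded polynomial ring $R$ and $\mathfrak p\in\mathrm{Ass}(I)$, $\mathrm{v}_{\mathfrak p}(I)=\min\{d\ge 0:\exists f\in R_d \text{ with } I:f=\mathfrak p\}$ and $\mathrm{v}(I)=\min_{\mathfrak p\in\mathrm{Ass}(I)}\mathrm{v}_{\mathfrak p}(I)$. Write $\mathrm{v}_T(J_{K_m,G})$ for $\mathrm{v}_{P_T(K_m,G)}(J_{K_m,G})$. *)

theory Defs
  imports "HOL-Library.Poly_Mapping" "HOL-Library.Extended_Nat" "HOL-Algebra.Ideal"
begin

section \<open>Polynomial rings on a set of variables\<close>

type_synonym ('x, 'k) mpoly = "('x \<Rightarrow>\<^sub>0 nat) \<Rightarrow>\<^sub>0 'k"

definition Var :: "'x \<Rightarrow> ('x, 'k::field) mpoly"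
  where "Var x = Poly_Mapping.single (Poly_Mapping.single x 1) 1"

text \<open>The ring \<open>K[X]\<close>: polynomials all of whose monomials involve only variables from \<open>X\<close>.\<close>

definition mpoly_ring :: "'x set \<Rightarrow> ('x, 'k::field) mpoly ring"
  where "mpoly_ring X =
    \<lparr>carrier = {p. \<forall>u \<in> Poly_Mapping.keys p. Poly_Mapping.keys u \<subseteq> X},
     monoid.mult = (*), one = 1, zero = 0, add = (+)\<rparr>"

definition monom_degree :: "('x \<Rightarrow>\<^sub>0 nat) \<Rightarrow> nat"
  where "monom_degree u = (\<Sum>x \<in> Poly_Mapping.keys u. Poly_Mapping.lookup u x)"

text \<open>The component \<open>K[X]\<^sub>d\<close> of the standard grading (containing \<open>0\<close>).\<close>

definition graded_component :: "'x set \<Rightarrow> nat \<Rightarrow> ('x, 'k::field) mpoly set"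
  where "graded_component X d =
    {p \<in> carrier (mpoly_ring X). \<forall>u \<in> Poly_Mapping.keys p. monom_degree u = d}"

lemma cring_mpoly_ring: "cring (mpoly_ring X :: ('x, 'k::field) mpoly ring)"
proof -
  let ?C = "{p :: ('x, 'k) mpoly. \<forall>u \<in> Poly_Mapping.keys p. Poly_Mapping.keys u \<subseteq> X}"
  have add: "p + q \<in> ?C" if "p \<in> ?C" "q \<in> ?C" for p q
    using that Poly_Mapping.keys_add[of p q] by blast
  have mult: "p * q \<in> ?C" if p: "p \<in> ?C" and q: "q \<in> ?C" for p q
  proof (clarify)
    fix u x assume u: "u \<in> Poly_Mapping.keys (p * q)" and x: "x \<in> Poly_Mapping.keys u"
    obtain a b where ab: "u = a + b" "a \<in> Poly_Mapping.keys p" "b \<in> Poly_Mapping.keys q"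
      using u keys_mult[of p q] by blast
    have "x \<in> Poly_Mapping.keys a \<union> Poly_Mapping.keys b"
      using x Poly_Mapping.keys_add[of a b] ab(1) by blast
    then show "x \<in> X" using p q ab(2,3) by blast
  qed
  have uminus: "- p \<in> ?C" if "p \<in> ?C" for p using that by simp
  have one: "(1 :: ('x, 'k) mpoly) \<in> ?C" by (simp flip: single_one)
  let ?R = "mpoly_ring X :: ('x, 'k) mpoly ring"
  have R: "carrier ?R = ?C" "\<And>p q. p \<otimes>\<^bsub>?R\<^esub> q = p * q" "\<And>p q. p \<oplus>\<^bsub>?R\<^esub> q = p + q"
    "\<one>\<^bsub>?R\<^esub> = 1" "\<zero>\<^bsub>?R\<^esub> = 0"
    by (simp_all add: mpoly_ring_def)
  have "abelian_group ?R"
  proof (rule abelian_groupI)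
    fix p assume "p \<in> carrier ?R"
    then show "\<exists>q \<in> carrier ?R. q \<oplus>\<^bsub>?R\<^esub> p = \<zero>\<^bsub>?R\<^esub>"
      using uminus[of p] unfolding R by (intro bexI[of _ "- p"]) (rule left_minus)
  next
    show "p \<oplus>\<^bsub>?R\<^esub> q \<in> carrier ?R" if "p \<in> carrier ?R" "q \<in> carrier ?R" for p q
      using that add unfolding R by blast
    show "\<zero>\<^bsub>?R\<^esub> \<in> carrier ?R" unfolding R by simp
  qed (simp_all only: R ac_simps add_0_left add_0_right)
  moreover have "comm_monoid ?R"
  proof (rule comm_monoidI)
    show "p \<otimes>\<^bsub>?R\<^esub> q \<in> carrier ?R" if "p \<in> carrier ?R" "q \<in> carrier ?R" for p q
      using that mult unfolding R by blast
    show "\<one>\<^bsub>?R\<^esub> \<in> carrier ?R" using one unfolding R by blast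
  qed (simp_all only: R ac_simps mult_1_left mult_1_right)
  ultimately show ?thesis
    by (rule cringI) (simp only: R distrib_right)
qed

section \<open>Associated primes and v-numbers\<close>

definition colon :: "('a, 'b) ring_scheme \<Rightarrow> 'a set \<Rightarrow> 'a \<Rightarrow> 'a set"
  where "colon R I f = {g \<in> carrier R. g \<otimes>\<^bsub>R\<^esub> f \<in> I}"

definition Ass :: "('a, 'b) ring_scheme \<Rightarrow> 'a set \<Rightarrow> 'a set set"
  where "Ass R I = {P. primeideal P R \<and> (\<exists>f \<in> carrier R. colon R I f = P)}"

text \<open>The values are extended naturals, so that a minimum over the empty set is \<open>\<infinity>\<close>.
  For graded \<open>I\<close> and \<open>P \<in> Ass I\<close>, the set in \<open>v_local\<close> is nonempty and its infimum is the minimum.\<close>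

definition v_local :: "'x set \<Rightarrow> ('x, 'k::field) mpoly set \<Rightarrow> ('x, 'k) mpoly set \<Rightarrow> enat"
  where "v_local X P I =
    Inf {enat d | d. \<exists>f \<in> graded_component X d. colon (mpoly_ring X) I f = P}"

definition v_number :: "'x set \<Rightarrow> ('x, 'k::field) mpoly set \<Rightarrow> enat"
  where "v_number X I = (INF P \<in> Ass (mpoly_ring X) I. v_local X P I)"

section \<open>Simple graphs\<close>

text \<open>A graph is given by its vertex set \<open>V\<close> and its set \<open>E\<close> of two-element edges.\<close>

definition simple_graph :: "'v set \<Rightarrow> 'v set set \<Rightarrow> bool"
  where "simple_graph V E \<longleftrightarrow> finite V \<and> (\<forall>e \<in> E. e \<subseteq> V \<and> card e = 2)"

definition adjacency :: "'v set set \<Rightarrow> ('v \<times> 'v) set"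
  where "adjacency E = {(u, v). {u, v} \<in> E}"

definition connected_graph :: "'v set \<Rightarrow> 'v set set \<Rightarrow> bool"
  where "connected_graph V E \<longleftrightarrow> V \<noteq> {} \<and> (\<forall>u \<in> V. \<forall>v \<in> V. (u, v) \<in> (adjacency E)\<^sup>*)"

definition graph_components :: "'v set \<Rightarrow> 'v set set \<Rightarrow> 'v set set"
  where "graph_components V E = V // ((adjacency E)\<^sup>* \<inter> V \<times> V)"

definition induced_edges :: "'v set set \<Rightarrow> 'v set \<Rightarrow> 'v set set"
  where "induced_edges E U = {e \<in> E. e \<subseteq> U}"

definition complete_edges :: "'v set \<Rightarrow> 'v set set"
  where "complete_edges U = {{u, v} | u v. u \<in> U \<and> v \<in> U \<and> u \<noteq> v}"

text \<open>Vertex sets of the components \<open>G\<^sub>1, \<dots>\<close> of the induced subgraph on \<open>[n] - T\<close>.\<close>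

definition components_without :: "nat \<Rightarrow> nat set set \<Rightarrow> nat set \<Rightarrow> nat set set"
  where "components_without n E T =
    graph_components ({1..n} - T) (induced_edges E ({1..n} - T))"

definition cut_set :: "nat \<Rightarrow> nat set set \<Rightarrow> nat set \<Rightarrow> bool"
  where "cut_set n E T \<longleftrightarrow> T \<subseteq> {1..n} \<and>
    (T = {} \<or> (\<forall>t \<in> T. card (components_without n E (T - {t})) < card (components_without n E T)))"

section \<open>Generalized binomial edge ideals\<close>

abbreviation grid :: "nat \<Rightarrow> nat \<Rightarrow> (nat \<times> nat) set"
  where "grid m n \<equiv> {1..m} \<times> {1..n}"

text \<open>The ideal of \<open>(K\<^sub>m, G)\<close> for the graph \<open>G\<close> on \<open>[n]\<close> with edge set \<open>E\<close>;
  \<open>m = 2\<close> gives the binomial edge ideal of \<open>G\<close>.\<close>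

definition gen_binomial_edge_ideal :: "nat \<Rightarrow> nat \<Rightarrow> nat set set \<Rightarrow> (nat \<times> nat, 'k::field) mpoly set"
  where "gen_binomial_edge_ideal m n E =
    Idl\<^bsub>mpoly_ring (grid m n)\<^esub>
      {Var (i, k) * Var (j, l) - Var (i, l) * Var (j, k) | i j k l.
         i \<in> {1..m} \<and> j \<in> {1..m} \<and> {k, l} \<in> E}"

text \<open>The sum of ideals is written as the ideal generated by their union.\<close>

definition P_cut :: "nat \<Rightarrow> nat \<Rightarrow> nat set set \<Rightarrow> nat set \<Rightarrow> (nat \<times> nat, 'k::field) mpoly set"
  where "P_cut m n E T =
    Idl\<^bsub>mpoly_ring (grid m n)\<^esub>
      ({Var (i, j) | i j. i \<in> {1..m} \<and> j \<in> T} \<union>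
       (\<Union>C \<in> components_without n E T. gen_binomial_edge_ideal m n (complete_edges C)))"

text \<open>The first argument of the following two functions only fixes the coefficient field.\<close>

definition v_cut_J :: "'k::field itself \<Rightarrow> nat \<Rightarrow> nat \<Rightarrow> nat set set \<Rightarrow> nat set \<Rightarrow> enat"
  where "v_cut_J K m n E T =
    v_local (grid m n) (P_cut m n E T :: (nat \<times> nat, 'k) mpoly set) (gen_binomial_edge_ideal m n E)"

definition v_J :: "'k::field itself \<Rightarrow> nat \<Rightarrow> nat \<Rightarrow> nat set set \<Rightarrow> enat"
  where "v_J K m n E =
    v_number (grid m n) (gen_binomial_edge_ideal m n E :: (nat \<times> nat, 'k) mpoly set)"

end

theory Submission
  imports Defs
begin

text \<open>Let \<open>S\<^sub>m\<close> be the polynomial ring, \<open>J\<^sub>m\<close> the ideal of \<open>(K\<^sub>m, G)\<close> and \<open>P\<^sub>T\<^sub>,\<^sub>m\<close> its ideal for \<open>T\<close>. The ideal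
  \<open>P\<^sub>T\<^sub>,\<^sub>m\<close> is the kernel on \<open>S\<^sub>m\<close> of a homomorphism to a polynomial ring that does not depend on \<open>m\<close>:
  it sends \<open>x\<^sub>i\<^sub>,\<^sub>j\<close> to \<open>0\<close> if \<open>j \<in> T\<close>, and otherwise to the product of a variable for \<open>j\<close> and a variable for
  \<open>i\<close> and the component of \<open>j\<close>. Hence \<open>P\<^sub>T\<^sub>,\<^sub>m\<close> is prime, and \<open>P\<^sub>T\<^sub>,\<^sub>m\<^sub>' \<inter> S\<^sub>m = P\<^sub>T\<^sub>,\<^sub>m\<close> for \<open>m \<le> m'\<close>.

  The ideal \<open>J\<^sub>m\<close> is the intersection of the \<open>P\<^sub>T\<^sub>,\<^sub>m\<close> over all \<open>T \<subseteq> {1..n}\<close>. No Groebner basis is needed: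
  a monomial of column support \<open>D\<close> is a distribution of coloured tokens in which each vertex of
  \<open>D\<close> has a token, a minor exchanges the tokens at the ends of an edge, and on a connected graph
  whose vertices all have tokens such exchanges generate all permutations of the tokens. So in
  column support \<open>D\<close> membership in \<open>J\<^sub>m\<close> is membership in \<open>P\<^sub>T\<^sub>,\<^sub>m\<close> for \<open>T = {1..n} - D\<close>.

  If \<open>J\<^sub>m : f = P\<^sub>T\<^sub>,\<^sub>m\<close>, then \<open>f \<notin> P\<^sub>T\<^sub>,\<^sub>m\<close>, and \<open>P\<^sub>T\<^sub>,\<^sub>m \<subseteq> P\<^sub>T\<^sub>'\<^sub>,\<^sub>m\<close> whenever \<open>f \<notin> P\<^sub>T\<^sub>'\<^sub>,\<^sub>m\<close>. Both properties
  pass from \<open>m\<close> to \<open>m'\<close>, so \<open>J\<^sub>m\<^sub>' : f = P\<^sub>T\<^sub>,\<^sub>m\<^sub>'\<close> for the same \<open>f\<close>.\<close>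

section \<open>Monomials and ideals\<close>

abbreviation mon :: "('x \<Rightarrow>\<^sub>0 nat) \<Rightarrow> ('x, 'k::field) mpoly"
  where "mon u \<equiv> Poly_Mapping.single u 1"

abbreviation var :: "'x \<Rightarrow> 'x \<Rightarrow>\<^sub>0 nat"
  where "var x \<equiv> Poly_Mapping.single x 1"

lemma mpoly_ring_simps:
  "carrier (mpoly_ring X) = {p. \<forall>u \<in> Poly_Mapping.keys p. Poly_Mapping.keys u \<subseteq> X}"
  "p \<otimes>\<^bsub>mpoly_ring X\<^esub> q = p * q" "p \<oplus>\<^bsub>mpoly_ring X\<^esub> q = p + q"
  "\<one>\<^bsub>mpoly_ring X\<^esub> = 1" "\<zero>\<^bsub>mpoly_ring X\<^esub> = 0"
  by (simp_all add: mpoly_ring_def)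

lemma carrier_mpoly_ring_mono: "X \<subseteq> Y \<Longrightarrow> carrier (mpoly_ring X) \<subseteq> carrier (mpoly_ring Y)"
  by (fastforce simp: mpoly_ring_simps)

lemma single_in_carrier: "Poly_Mapping.keys u \<subseteq> X \<Longrightarrow> Poly_Mapping.single u a \<in> carrier (mpoly_ring X)"
  by (simp add: mpoly_ring_simps)

lemma keys_add_nat: "Poly_Mapping.keys (u + v) = Poly_Mapping.keys u \<union> Poly_Mapping.keys v"
  for u v :: "'x \<Rightarrow>\<^sub>0 nat"
  by (auto simp: in_keys_iff lookup_add)

lemma binomial_eq_mon: "Var a * Var b - Var c * Var d = mon (var a + var b) - mon (var c + var d)"
  by (simp add: Var_def mult_single)

lemma minus_in_carrier:
  assumes "p \<in> carrier (mpoly_ring X)" "q \<in> carrier (mpoly_ring X)"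
  shows "p - q \<in> carrier (mpoly_ring X)"
  using assms keys_diff[of p q] unfolding mpoly_ring_simps by blast

lemma sum_singles: "(\<Sum>u \<in> Poly_Mapping.keys p. Poly_Mapping.single u (Poly_Mapping.lookup p u)) = p"
  by (rule poly_mapping_eqI) (auto simp: lookup_sum lookup_single when_def in_keys_iff)

locale mpoly_ideal =
  fixes X :: "'x set" and I :: "('x, 'k::field) mpoly set"
  assumes ideal: "ideal I (mpoly_ring X)"
begin

sublocale ideal I "mpoly_ring X" by (rule ideal)

lemma subset_carrier: "p \<in> I \<Longrightarrow> p \<in> carrier (mpoly_ring X)"
  by (rule a_Hcarr)

lemma zero_in: "0 \<in> I"
  using additive_subgroup.zero_closed[OF is_additive_subgroup] by (simp add: mpoly_ring_simps)

lemma add_in: "p \<in> I \<Longrightarrow> q \<in> I \<Longrightarrow> p + q \<in> I"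
  using additive_subgroup.a_closed[OF is_additive_subgroup, of p q] by (simp add: mpoly_ring_simps)

lemma mult_in: "p \<in> I \<Longrightarrow> q \<in> carrier (mpoly_ring X) \<Longrightarrow> q * p \<in> I"
  using I_l_closed[of p q] by (simp add: mpoly_ring_simps)

lemma single_mult_in: "p \<in> I \<Longrightarrow> Poly_Mapping.keys u \<subseteq> X \<Longrightarrow> Poly_Mapping.single u a * p \<in> I"
  by (rule mult_in[OF _ single_in_carrier])

lemma uminus_in: "p \<in> I \<Longrightarrow> - p \<in> I"
  using single_mult_in[of p 0 "-1"] by (simp add: single_uminus)

lemma diff_in: "p \<in> I \<Longrightarrow> q \<in> I \<Longrightarrow> p - q \<in> I"
  using add_in[OF _ uminus_in] by fastforce

lemma sum_in: "(\<And>a. a \<in> A \<Longrightarrow> g a \<in> I) \<Longrightarrow> sum g A \<in> I"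
  by (induction A rule: infinite_finite_induct) (auto simp: zero_in add_in)

lemma diff_trans_in: "p - q \<in> I \<Longrightarrow> q - r \<in> I \<Longrightarrow> p - r \<in> I"
  using add_in[of "p - q" "q - r"] by simp

lemma mon_diff_shift_in:
  assumes "mon u - mon v \<in> I" "Poly_Mapping.keys w \<subseteq> X"
  shows "mon (w + u) - mon (w + v) \<in> I"
  using single_mult_in[OF assms, of 1] by (simp add: right_diff_distrib mult_single)

text \<open>Modulo \<open>I\<close>, each monomial may be replaced by a representative of its \<open>\<kappa>\<close>-class.\<close>

lemma in_ideal_by_classes:
  assumes f: "f \<in> carrier (mpoly_ring X)"
    and cong: "\<And>u v. u \<in> Poly_Mapping.keys f \<Longrightarrow> v \<in> Poly_Mapping.keys f \<Longrightarrow> \<kappa> u = \<kappa> v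
      \<Longrightarrow> mon u - mon v \<in> I"
    and sums: "\<And>u. u \<in> Poly_Mapping.keys f \<Longrightarrow> mon u \<in> I \<or>
      (\<Sum>v \<in> {v \<in> Poly_Mapping.keys f. \<kappa> v = \<kappa> u}. Poly_Mapping.lookup f v) = 0"
  shows "f \<in> I"
proof -
  let ?S = "\<lambda>c. {v \<in> Poly_Mapping.keys f. \<kappa> v = c}"
  have "(\<Sum>v \<in> ?S c. Poly_Mapping.single v (Poly_Mapping.lookup f v)) \<in> I"
    if c: "c \<in> \<kappa> ` Poly_Mapping.keys f" for c
  proof -
    obtain u where u: "u \<in> Poly_Mapping.keys f" "c = \<kappa> u" using c by blast
    let ?a = "\<Sum>v \<in> ?S c. Poly_Mapping.lookup f v"
    have uX: "Poly_Mapping.keys u \<subseteq> X" using f u by (auto simp: mpoly_ring_simps)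
    \<comment> \<open>Modulo \<open>I\<close> the part of \<open>f\<close> in this class is its
      coefficient sum times the representative \<open>mon u\<close>; by \<open>sums\<close>, one of
      these two factors makes the product vanish modulo \<open>I\<close>.\<close>
    have "(\<Sum>v \<in> ?S c. Poly_Mapping.single v (Poly_Mapping.lookup f v)) =
       (\<Sum>v \<in> ?S c. Poly_Mapping.single 0 (Poly_Mapping.lookup f v) * (mon v - mon u)) +
       Poly_Mapping.single 0 ?a * mon u"
    proof -
      have "Poly_Mapping.single 0 (\<Sum>v \<in> A. g v) * mon u = (\<Sum>v \<in> A. Poly_Mapping.single 0 (g v) * mon u)"
        if "finite A" for A and g :: "('x \<Rightarrow>\<^sub>0 nat) \<Rightarrow> 'k"
        using that by (induction A) (simp_all add: single_add distrib_right)
      then show ?thesis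
        by (simp add: right_diff_distrib mult_single sum_subtractf)
    qed
    moreover have "(\<Sum>v \<in> ?S c. Poly_Mapping.single 0 (Poly_Mapping.lookup f v) * (mon v - mon u)) \<in> I"
      using u cong by (intro sum_in single_mult_in) auto
    moreover have "Poly_Mapping.single 0 ?a * mon u \<in> I"
      using sums[OF u(1)]
    proof
      assume "mon u \<in> I" then show ?thesis by (rule single_mult_in) simp
    next
      assume "(\<Sum>v \<in> ?S (\<kappa> u). Poly_Mapping.lookup f v) = 0"
      then show ?thesis using u(2) by (simp add: zero_in)
    qed
    ultimately show ?thesis using add_in by simp
  qed
  then have "(\<Sum>c \<in> \<kappa> ` Poly_Mapping.keys f. \<Sum>v \<in> ?S c. Poly_Mapping.single v (Poly_Mapping.lookup f v)) \<in> I"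
    by (rule sum_in)
  then show ?thesis
    by (simp add: sum_singles flip: sum.image_gen)
qed

end

text \<open>Negation is multiplication by the ring element \<open>- 1\<close>, so closure under
  additive inverses follows from \<open>mult\<close>.\<close>

lemma idealI_mpoly:
  fixes X :: "'x set" and I :: "('x, 'k::field) mpoly set"
  assumes "I \<subseteq> carrier (mpoly_ring X)" "0 \<in> I"
    and "\<And>p q. p \<in> I \<Longrightarrow> q \<in> I \<Longrightarrow> p + q \<in> I"
    and mult: "\<And>p q. p \<in> I \<Longrightarrow> q \<in> carrier (mpoly_ring X) \<Longrightarrow> q * p \<in> I"
  shows "ideal I (mpoly_ring X)"
proof -
  interpret cring "mpoly_ring X :: ('x, 'k) mpoly ring" by (rule cring_mpoly_ring)
  have neg: "\<ominus>\<^bsub>mpoly_ring X\<^esub> p = - p" if p: "p \<in> carrier (mpoly_ring X)" for p :: "('x, 'k) mpoly"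
    by (rule minus_equality) (use p in \<open>auto simp: mpoly_ring_simps\<close>)
  have m1: "(- 1 :: ('x, 'k) mpoly) \<in> carrier (mpoly_ring X)" by (simp add: mpoly_ring_simps)
  show ?thesis
  proof (rule idealI)
    show "ring (mpoly_ring X :: ('x, 'k) mpoly ring)" by (rule ring_axioms)
    show "subgroup I (add_monoid (mpoly_ring X))"
    proof (rule subgroup.intro)
      fix x assume x: "x \<in> I"
      with assms(1) neg mult[OF x m1] have "\<ominus>\<^bsub>mpoly_ring X\<^esub> x \<in> I" by auto
      then show "inv\<^bsub>add_monoid (mpoly_ring X)\<^esub> x \<in> I" by (simp add: a_inv_def)
    qed (use assms in \<open>auto simp: mpoly_ring_simps\<close>)
    fix a x :: "('x, 'k) mpoly" assume "a \<in> I" "x \<in> carrier (mpoly_ring X)"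
    with mult[of a x] show "x \<otimes>\<^bsub>mpoly_ring X\<^esub> a \<in> I" "a \<otimes>\<^bsub>mpoly_ring X\<^esub> x \<in> I"
      by (simp_all add: mpoly_ring_simps mult.commute)
  qed
qed

section \<open>Monomial substitutions\<close>

text \<open>This linear map becomes a ring homomorphism once \<open>h\<close> is additive and
  \<open>A\<close> multiplicative. The predicate \<open>A\<close> allows variables to be sent to
  \<open>0\<close>, which no exponent vector can express.\<close>

definition subst_monomials ::
    "(('x \<Rightarrow>\<^sub>0 nat) \<Rightarrow> bool) \<Rightarrow> (('x \<Rightarrow>\<^sub>0 nat) \<Rightarrow> 'y \<Rightarrow>\<^sub>0 nat) \<Rightarrow> ('x, 'k::field) mpoly \<Rightarrow> ('y, 'k) mpoly"
  where "subst_monomials A h p =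
    (\<Sum>u \<in> Poly_Mapping.keys p. if A u then Poly_Mapping.single (h u) (Poly_Mapping.lookup p u) else 0)"

lemma subst_monomials_eq_sum:
  assumes "finite S" "Poly_Mapping.keys p \<subseteq> S"
  shows "subst_monomials A h p =
    (\<Sum>u \<in> S. if A u then Poly_Mapping.single (h u) (Poly_Mapping.lookup p u) else 0)"
  unfolding subst_monomials_def using assms
  by (intro sum.mono_neutral_left) (auto simp: in_keys_iff)

lemma subst_monomials_0 [simp]: "subst_monomials A h 0 = 0"
  by (simp add: subst_monomials_def)

lemma subst_monomials_add: "subst_monomials A h (p + q) = subst_monomials A h p + subst_monomials A h q"
proof -
  let ?S = "Poly_Mapping.keys p \<union> Poly_Mapping.keys q"
  have "subst_monomials A h r =
      (\<Sum>u \<in> ?S. if A u then Poly_Mapping.single (h u) (Poly_Mapping.lookup r u) else 0)"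
    if "Poly_Mapping.keys r \<subseteq> ?S" for r
    using that by (intro subst_monomials_eq_sum) auto
  from this[of p] this[of q] this[of "p + q"] show ?thesis
    using Poly_Mapping.keys_add[of p q]
    by (auto simp: lookup_add single_add simp flip: sum.distrib intro!: sum.cong)
qed

lemma subst_monomials_sum: "subst_monomials A h (sum g S) = (\<Sum>s \<in> S. subst_monomials A h (g s))"
  by (induction S rule: infinite_finite_induct) (auto simp: subst_monomials_add)

lemma subst_monomials_single:
  "subst_monomials A h (Poly_Mapping.single u a) = (if A u then Poly_Mapping.single (h u) a else 0)"
  by (simp add: subst_monomials_def)

lemma subst_monomials_diff: "subst_monomials A h (p - q) = subst_monomials A h p - subst_monomials A h q"
  using subst_monomials_add[of A h "p - q" q] by simp

text \<open>Coefficients of the image are sums over fibres of \<open>h\<close>. Thus a vanishing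
  image supplies the condition \<open>sums\<close> of \<open>in_ideal_by_classes\<close>.\<close>

lemma lookup_subst_monomials:
  "Poly_Mapping.lookup (subst_monomials A h p) c =
    (\<Sum>u \<in> {u \<in> Poly_Mapping.keys p. A u \<and> h u = c}. Poly_Mapping.lookup p u)"
  unfolding subst_monomials_def lookup_sum
  by (intro sum.mono_neutral_cong_right) (auto simp: lookup_single when_def)

lemma subst_monomials_mult:
  assumes A: "\<And>u v. A (u + v) \<longleftrightarrow> A u \<and> A v" and h: "\<And>u v. h (u + v) = h u + h v"
  shows "subst_monomials A h (p * q) = subst_monomials A h p * subst_monomials A h q"
proof -
  have "p * q = (\<Sum>u \<in> Poly_Mapping.keys p. \<Sum>v \<in> Poly_Mapping.keys q.
      Poly_Mapping.single (u + v) (Poly_Mapping.lookup p u * Poly_Mapping.lookup q v))"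
    by (subst (1 2) sum_singles[symmetric]) (simp only: sum_product mult_single)
  also have "subst_monomials A h \<dots> = (\<Sum>u \<in> Poly_Mapping.keys p. \<Sum>v \<in> Poly_Mapping.keys q.
      (if A u then Poly_Mapping.single (h u) (Poly_Mapping.lookup p u) else 0) *
      (if A v then Poly_Mapping.single (h v) (Poly_Mapping.lookup q v) else 0))"
    by (auto simp: subst_monomials_sum subst_monomials_single A h mult_single intro!: sum.cong)
  also have "\<dots> = subst_monomials A h p * subst_monomials A h q"
    by (simp add: subst_monomials_def sum_product)
  finally show ?thesis .
qed

text \<open>The linear order on \<open>'y\<close> makes the target a domain, so the kernel is prime;
  \<open>A 0\<close> gives \<open>1\<close> the image \<open>1\<close>, so it is proper.\<close>

lemma primeideal_subst_kernel:
  fixes h :: "('x \<Rightarrow>\<^sub>0 nat) \<Rightarrow> 'y::linorder \<Rightarrow>\<^sub>0 nat"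
  assumes A: "\<And>u v. A (u + v) \<longleftrightarrow> A u \<and> A v" "A 0" and h: "\<And>u v. h (u + v) = h u + h v"
  shows "primeideal {p \<in> carrier (mpoly_ring X :: ('x, 'k::field) mpoly ring). subst_monomials A h p = 0}
    (mpoly_ring X)" (is "primeideal ?I ?R")
proof (rule primeidealI)
  note mult = subst_monomials_mult[of A h, OF A(1) h]
  have h0: "h 0 = 0" using h[of 0 0] by simp
  interpret cring ?R by (rule cring_mpoly_ring)
  show "ideal ?I ?R"
    using zero_closed add.m_closed m_closed
    by (intro idealI_mpoly) (auto simp: mult subst_monomials_add mpoly_ring_simps(2-5))
  show "cring ?R" by (rule cring_mpoly_ring)
  have "subst_monomials A h (1 :: ('x, 'k) mpoly) = 1"
    using subst_monomials_single[of A h 0 1] A(2) h0 by simp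
  then have "1 \<notin> ?I" by simp
  then show "carrier ?R \<noteq> ?I" using one_closed unfolding mpoly_ring_simps(4) by blast
  show "a \<in> ?I \<or> b \<in> ?I" if "a \<in> carrier ?R" "b \<in> carrier ?R" "a \<otimes>\<^bsub>?R\<^esub> b \<in> ?I" for a b
    using that by (auto simp: mult mpoly_ring_simps(2))
qed

section \<open>Splitting off a variable and induction on monomials\<close>

lemma var_split:
  fixes u :: "'x \<Rightarrow>\<^sub>0 nat"
  assumes "x \<in> Poly_Mapping.keys u"
  obtains u' where "u = var x + u'"
proof
  show "u = var x + (u - var x)"
    using assms
    by (intro poly_mapping_eqI) (auto simp: lookup_add minus_poly_mapping.rep_eq lookup_single when_def in_keys_iff)
qed

lemma monomial_induct [case_names zero add_var]:
  fixes u :: "'x \<Rightarrow>\<^sub>0 nat"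
  assumes zero: "P 0" and step: "\<And>x u. P u \<Longrightarrow> P (var x + u)"
  shows "P u"
proof (induction "\<Sum>x \<in> Poly_Mapping.keys u. Poly_Mapping.lookup u x" arbitrary: u rule: less_induct)
  case less
  show ?case
  proof (cases "u = 0")
    case False
    then obtain x where x: "x \<in> Poly_Mapping.keys u" using keys_eq_empty by blast
    then obtain u' where u: "u = var x + u'" by (rule var_split)
    have "(\<Sum>y \<in> Poly_Mapping.keys u'. Poly_Mapping.lookup u' y) \<le> (\<Sum>y \<in> Poly_Mapping.keys u. Poly_Mapping.lookup u' y)"
      by (rule sum_mono2) (auto simp: u keys_add_nat)
    also have "\<dots> < (\<Sum>y \<in> Poly_Mapping.keys u. Poly_Mapping.lookup u y)"
      using x by (intro sum_strict_mono_ex1 bexI[of _ x]) (auto simp: u lookup_add)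
    finally have "P u'" by (rule less)
    then show ?thesis unfolding u by (rule step)
  qed (simp add: zero)
qed

section \<open>Column degrees and row degrees\<close>

text \<open>The exponent of the image of \<open>u\<close> under \<open>x\<^sub>i\<^sub>,\<^sub>j \<mapsto> t\<^sub>j s\<^sub>i\<^sub>,\<^sub>c\<^sub>(\<^sub>j\<^sub>)\<close>, where
  \<open>c\<close> assigns to each vertex the name of its component. The variables \<open>t\<^sub>j\<close> and \<open>s\<^sub>i\<^sub>,\<^sub>d\<close> are
  numbered by \<open>prod_encode (0, j)\<close> and \<open>prod_encode (Suc i, d)\<close>: an index type with a linear order
  makes the target a domain.\<close>

definition profile :: "(nat \<Rightarrow> nat) \<Rightarrow> (nat \<times> nat \<Rightarrow>\<^sub>0 nat) \<Rightarrow> nat \<Rightarrow>\<^sub>0 nat"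
  where "profile c u = (\<Sum>x \<in> Poly_Mapping.keys u.
    Poly_Mapping.single (prod_encode (0, snd x)) (Poly_Mapping.lookup u x) +
    Poly_Mapping.single (prod_encode (Suc (fst x), c (snd x))) (Poly_Mapping.lookup u x))"

lemma profile_add: "profile c (u + v) = profile c u + profile c v"
proof -
  let ?S = "Poly_Mapping.keys u \<union> Poly_Mapping.keys v"
  have "profile c r = (\<Sum>x \<in> ?S.
      Poly_Mapping.single (prod_encode (0, snd x)) (Poly_Mapping.lookup r x) +
      Poly_Mapping.single (prod_encode (Suc (fst x), c (snd x))) (Poly_Mapping.lookup r x))"
    if "Poly_Mapping.keys r \<subseteq> ?S" for r
    unfolding profile_def using that
    by (intro sum.mono_neutral_left) (auto simp: in_keys_iff)
  from this[of u] this[of v] this[of "u + v"] show ?thesis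
    by (simp add: keys_add_nat lookup_add single_add algebra_simps flip: sum.distrib)
qed

lemma profile_var: "profile c (var (i, j)) =
    var (prod_encode (0, j)) + var (prod_encode (Suc i, c j))"
  by (simp add: profile_def)

lemma keys_profile_iff:
  "y \<in> Poly_Mapping.keys (profile c u) \<longleftrightarrow>
    (\<exists>x \<in> Poly_Mapping.keys u. y = prod_encode (0, snd x) \<or> y = prod_encode (Suc (fst x), c (snd x)))"
  by (auto simp: profile_def in_keys_iff lookup_sum lookup_add lookup_single when_def)

lemma column_in_keys_profile_iff:
  "prod_encode (0, j) \<in> Poly_Mapping.keys (profile c u) \<longleftrightarrow> j \<in> snd ` Poly_Mapping.keys u"
  by (auto simp: keys_profile_iff prod_encode_eq)

lemma row_in_keys_profile_iff:
  "prod_encode (Suc i, d) \<in> Poly_Mapping.keys (profile c u) \<longleftrightarrow>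
    (\<exists>j. (i, j) \<in> Poly_Mapping.keys u \<and> c j = d)"
  by (force simp: keys_profile_iff prod_encode_eq)

lemma columns_eq_if_profile_eq:
  "profile c u = profile c v \<Longrightarrow> snd ` Poly_Mapping.keys u = snd ` Poly_Mapping.keys v"
  by (simp only: set_eq_iff column_in_keys_profile_iff[of _ c, symmetric] simp_thms)

section \<open>Moving tokens along edges\<close>

text \<open>A monomial is a distribution of tokens: an exponent \<open>a\<close> of \<open>x\<^sub>i\<^sub>,\<^sub>k\<close> stands for \<open>a\<close> tokens of
  colour \<open>i\<close> at the vertex \<open>k\<close>. A minor exchanges two tokens at adjacent vertices.\<close>

lemma mon_diff_in_if_profile_eq:
  fixes u v w :: "nat \<times> nat \<Rightarrow>\<^sub>0 nat" and I :: "(nat \<times> nat, 'k::field) mpoly set"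
  assumes I: "mpoly_ideal X I" and X: "X = R \<times> C"
    and swap: "\<And>i j k l w. i \<in> R \<Longrightarrow> j \<in> R \<Longrightarrow> k \<in> D \<Longrightarrow> l \<in> D \<Longrightarrow> c k = c l \<Longrightarrow>
      Poly_Mapping.keys w \<subseteq> X \<Longrightarrow> D \<subseteq> snd ` Poly_Mapping.keys (w + (var (i, k) + var (j, l))) \<Longrightarrow>
      mon (w + (var (i, k) + var (j, l))) - mon (w + (var (i, l) + var (j, k))) \<in> I"
    and keys: "Poly_Mapping.keys w \<subseteq> X" "Poly_Mapping.keys u \<subseteq> X" "Poly_Mapping.keys v \<subseteq> X"
    and D: "snd ` Poly_Mapping.keys u \<subseteq> D" "D \<subseteq> snd ` Poly_Mapping.keys (w + u)"
    and profile: "profile c u = profile c v"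
  shows "mon (w + u) - mon (w + v) \<in> I"
proof -
  interpret mpoly_ideal X I by (rule I)
  show ?thesis using keys D profile
  proof (induction u arbitrary: w v rule: monomial_induct)
    case zero
    then have "Poly_Mapping.keys v = {}" using columns_eq_if_profile_eq[of c 0 v] by simp
    then show ?case by (simp add: zero_in)
  next
    case (add_var x u')
    obtain i k where x: "x = (i, k)" by fastforce
    have cols: "snd ` Poly_Mapping.keys (var x + u') = snd ` Poly_Mapping.keys v"
      using add_var.prems(6) by (rule columns_eq_if_profile_eq)
    have "prod_encode (Suc i, c k) \<in> Poly_Mapping.keys (profile c (var x + u'))"
      unfolding row_in_keys_profile_iff by (auto simp: x keys_add_nat)
    \<comment> \<open>The token of colour \<open>i\<close> at \<open>k\<close> in the first monomial
      has a partner of the same colour in \<open>v\<close>, at some \<open>l\<close> in the same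
      component. It is to be moved to \<open>k\<close>.\<close>
    then obtain l where l: "(i, l) \<in> Poly_Mapping.keys v" "c l = c k"
      unfolding add_var.prems(6) row_in_keys_profile_iff by blast
    obtain v1 where v1: "v = var (i, l) + v1" using l(1) by (rule var_split)
    \<comment> \<open>The matched token joins the fixed part \<open>w\<close>, so the whole monomial
      still has a token in each column of \<open>D\<close>.\<close>
    have IH: "mon ((w + var x) + u') - mon ((w + var x) + v') \<in> I"
      if "Poly_Mapping.keys v' \<subseteq> X" "profile c u' = profile c v'" for v'
      using add_var.prems that by (intro add_var.IH) (auto simp: keys_add_nat)
    show ?case
    proof (cases "l = k")
      case True
      then have "mon ((w + var x) + u') - mon ((w + var x) + v1) \<in> I"
        using add_var.prems(3,6) by (intro IH) (auto simp: x v1 profile_add keys_add_nat)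
      then show ?thesis using True by (simp add: x v1 ac_simps)
    next
      case False
      \<comment> \<open>Equal column supports give \<open>v\<close> a token at \<open>k\<close>, of
        some colour \<open>j\<close>. Exchanging it with the token at \<open>l\<close> keeps the
        profile, as \<open>c l = c k\<close>.\<close>
      have "k \<in> snd ` Poly_Mapping.keys v" unfolding cols[symmetric] by (force simp: x keys_add_nat)
      then obtain j where "(j, k) \<in> Poly_Mapping.keys v1" using False by (auto simp: v1 keys_add_nat)
      then obtain v2 where v2: "v1 = var (j, k) + v2" by (rule var_split)
      have "mon ((w + var x) + u') - mon ((w + var x) + (var (j, l) + v2)) \<in> I"
      proof (rule IH)
        show "Poly_Mapping.keys (var (j, l) + v2) \<subseteq> X"
          using add_var.prems(3) by (auto simp: v1 v2 keys_add_nat X)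
        show "profile c u' = profile c (var (j, l) + v2)"
          by (rule add_left_imp_eq[of "profile c (var x)"]) (use add_var.prems(6) l(2) in
            \<open>simp add: x v1 v2 profile_add profile_var ac_simps del: One_nat_def\<close>)
      qed
      moreover have "mon ((w + v2) + (var (i, k) + var (j, l))) - mon ((w + v2) + (var (i, l) + var (j, k))) \<in> I"
      proof (rule swap)
        show "l \<in> D" using cols l add_var.prems(4) by force
        show "D \<subseteq> snd ` Poly_Mapping.keys (w + v2 + (var (i, k) + var (j, l)))"
          using add_var.prems(5) cols by (auto simp: v1 v2 keys_add_nat image_Un)
      qed (use add_var.prems l in \<open>auto simp: x v1 v2 keys_add_nat X\<close>)
      ultimately show ?thesis
        using diff_trans_in[of "mon (w + (var x + u'))" "mon (w + (var x + (var (j, l) + v2)))" "mon (w + v)"]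
        by (simp add: x v1 v2 ac_simps)
    qed
  qed
qed

text \<open>If each vertex of \<open>D\<close> carries a token, then tokens at \<open>k\<close> and \<open>l\<close> are exchanged along a path
  \<open>k, \<dots>, l', l\<close> by exchanging the token at \<open>l\<close> with one at \<open>l'\<close>, before and after the exchange
  between \<open>k\<close> and \<open>l'\<close>.\<close>

lemma swap_along_path:
  fixes w :: "nat \<times> nat \<Rightarrow>\<^sub>0 nat" and I :: "(nat \<times> nat, 'k::field) mpoly set"
  assumes I: "mpoly_ideal X I" and X: "X = R \<times> C" and B: "B \<subseteq> D \<times> D" "D \<subseteq> C"
    and edge: "\<And>i j k l. i \<in> R \<Longrightarrow> j \<in> R \<Longrightarrow> (k, l) \<in> B \<Longrightarrow>
      mon (var (i, k) + var (j, l)) - mon (var (i, l) + var (j, k)) \<in> I"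
    and path: "(k, l) \<in> B\<^sup>*"
    and "i \<in> R" "j \<in> R" "Poly_Mapping.keys w \<subseteq> X" "k \<in> C"
      "D \<subseteq> snd ` Poly_Mapping.keys (w + (var (i, k) + var (j, l)))"
  shows "mon (w + (var (i, k) + var (j, l))) - mon (w + (var (i, l) + var (j, k))) \<in> I"
proof -
  interpret mpoly_ideal X I by (rule I)
  show ?thesis using path assms(7-)
  proof (induction arbitrary: w i j rule: rtrancl_induct)
    case base
    then show ?case by (simp add: zero_in)
  next
    case (step l' l)
    have D: "l' \<in> D" "l \<in> D" using step.hyps B by auto
    show ?case
    proof (cases "l' = k \<or> l' = l")
      case True
      then show ?thesis
      proof
        assume "l' = k"
        with step.prems step.hyps show ?thesis by (intro mon_diff_shift_in edge) auto
      next
        assume "l' = l"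
        with step.IH[of i j w] step.prems show ?thesis by simp
      qed
    next
      case False
      \<comment> \<open>As \<open>l'\<close> differs from \<open>k\<close> and \<open>l\<close>, its
        token, of colour \<open>a\<close>, lies in \<open>w\<close>. The three exchanges below act
        at \<open>l', l\<close>, then \<open>k, l'\<close>, then \<open>l', l\<close>; the last one
        returns \<open>a\<close> to \<open>l'\<close>.\<close>
      have "l' \<in> snd ` Poly_Mapping.keys (w + (var (i, k) + var (j, l)))" using D step.prems by blast
      then obtain a where a: "(a, l') \<in> Poly_Mapping.keys w" using False by (auto simp: keys_add_nat)
      then obtain w' where w: "w = var (a, l') + w'" by (rule var_split)
      have aR: "a \<in> R" and w'X: "Poly_Mapping.keys w' \<subseteq> X"
        using step.prems(3) by (auto simp: w X keys_add_nat)
      have "mon ((w' + var (i, k)) + (var (a, l') + var (j, l))) - mon ((w' + var (i, k)) + (var (a, l) + var (j, l'))) \<in> I"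
        using step.prems step.hyps aR w'X by (intro mon_diff_shift_in edge) (auto simp: keys_add_nat X)
      moreover have "mon ((w' + var (a, l)) + (var (i, k) + var (j, l'))) - mon ((w' + var (a, l)) + (var (i, l') + var (j, k))) \<in> I"
        using step.prems aR w'X B D by (intro step.IH) (auto simp: keys_add_nat X w image_Un)
      moreover have "mon ((w' + var (j, k)) + (var (i, l') + var (a, l))) - mon ((w' + var (j, k)) + (var (i, l) + var (a, l'))) \<in> I"
        using step.prems step.hyps aR w'X by (intro mon_diff_shift_in edge) (auto simp: keys_add_nat X)
      ultimately show ?thesis
        using diff_trans_in[of "mon (w' + (var (i, k) + (var (a, l') + var (j, l))))" "mon (w' + (var (i, k) + (var (a, l) + var (j, l'))))"
          "mon (w' + (var (i, l') + (var (a, l) + var (j, k))))"]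
          diff_trans_in[of "mon (w' + (var (i, k) + (var (a, l') + var (j, l))))" "mon (w' + (var (i, l') + (var (a, l) + var (j, k))))"
            "mon (w' + (var (i, l) + (var (a, l') + var (j, k))))"]
        by (simp add: w ac_simps)
    qed
  qed
qed

section \<open>Components of induced subgraphs\<close>

text \<open>The closure is taken on all of \<open>nat\<close>, where each vertex outside
  \<open>{1..n} - T\<close> is a class of its own; this makes it an equivalence on
  \<open>UNIV\<close>.\<close>

definition comp_rel :: "nat \<Rightarrow> nat set set \<Rightarrow> nat set \<Rightarrow> (nat \<times> nat) set"
  where "comp_rel n E T = (adjacency (induced_edges E ({1..n} - T)))\<^sup>*"

text \<open>The least member names the component by a natural number, as \<open>profile\<close>
  requires.\<close>

definition comp_name :: "nat \<Rightarrow> nat set set \<Rightarrow> nat set \<Rightarrow> nat \<Rightarrow> nat"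
  where "comp_name n E T k = (LEAST l. (k, l) \<in> comp_rel n E T)"

lemma equiv_comp_rel: "equiv UNIV (comp_rel n E T)"
proof -
  have "sym (adjacency F)" for F :: "nat set set"
    by (auto simp: sym_def adjacency_def insert_commute)
  then show ?thesis
    by (simp add: comp_rel_def equiv_def refl_rtrancl sym_rtrancl trans_rtrancl)
qed

lemma comp_name_eq_iff: "comp_name n E T k = comp_name n E T l \<longleftrightarrow> (k, l) \<in> comp_rel n E T"
proof
  have "(j, comp_name n E T j) \<in> comp_rel n E T" for j
    unfolding comp_name_def by (rule LeastI[of _ j]) (simp add: comp_rel_def)
  moreover assume "comp_name n E T k = comp_name n E T l"
  ultimately show "(k, l) \<in> comp_rel n E T"
    using equiv_comp_rel[of n E T] by (metis equivE symD transD)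
next
  assume "(k, l) \<in> comp_rel n E T"
  then have "(k, j) \<in> comp_rel n E T \<longleftrightarrow> (l, j) \<in> comp_rel n E T" for j
    using equiv_comp_rel[of n E T] by (meson equivE symD transD)
  then show "comp_name n E T k = comp_name n E T l" by (simp add: comp_name_def)
qed

lemma component_same_name:
  assumes "C \<in> components_without n E T" "k \<in> C" "l \<in> C"
  shows "k \<in> {1..n} - T" "l \<in> {1..n} - T" "comp_name n E T k = comp_name n E T l"
proof -
  obtain j where "C = (comp_rel n E T \<inter> ({1..n} - T) \<times> ({1..n} - T)) `` {j}"
    using assms(1) by (auto simp: components_without_def graph_components_def comp_rel_def elim!: quotientE)
  then have kl: "(j, k) \<in> comp_rel n E T" "(j, l) \<in> comp_rel n E T"
    and "k \<in> {1..n} - T" "l \<in> {1..n} - T"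
    using assms(2,3) by auto
  then show "k \<in> {1..n} - T" "l \<in> {1..n} - T" by blast+
  show "comp_name n E T k = comp_name n E T l"
    using kl[folded comp_name_eq_iff] by simp
qed

lemma obtain_component:
  assumes "k \<in> {1..n} - T" "l \<in> {1..n} - T" "comp_name n E T k = comp_name n E T l"
  obtains C where "C \<in> components_without n E T" "k \<in> C" "l \<in> C"
proof
  let ?C = "(comp_rel n E T \<inter> ({1..n} - T) \<times> ({1..n} - T)) `` {k}"
  show "?C \<in> components_without n E T"
    unfolding components_without_def graph_components_def comp_rel_def using assms(1) by (rule quotientI)
  show "k \<in> ?C" "l \<in> ?C"
    using assms by (auto simp: comp_name_eq_iff[symmetric])
qed

section \<open>The ideals as kernels\<close>

definition minor :: "nat \<Rightarrow> nat \<Rightarrow> nat \<Rightarrow> nat \<Rightarrow> (nat \<times> nat, 'k::field) mpoly"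
  where "minor i j k l = mon (var (i, k) + var (j, l)) - mon (var (i, l) + var (j, k))"

lemma gen_binomial_edge_ideal_eq: "gen_binomial_edge_ideal m n E =
    Idl\<^bsub>mpoly_ring (grid m n)\<^esub> {minor i j k l | i j k l. i \<in> {1..m} \<and> j \<in> {1..m} \<and> {k, l} \<in> E}"
  by (simp add: gen_binomial_edge_ideal_def minor_def binomial_eq_mon)

lemma minor_in_carrier:
  assumes "i \<in> {1..m}" "j \<in> {1..m}" "k \<in> {1..n}" "l \<in> {1..n}"
  shows "minor i j k l \<in> carrier (mpoly_ring (grid m n))"
  unfolding minor_def using assms
  by (intro minus_in_carrier single_in_carrier) (auto simp: keys_add_nat)

context
  fixes m n :: nat and E :: "nat set set"
  assumes E: "\<And>e. e \<in> E \<Longrightarrow> e \<subseteq> {1..n}"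
begin

lemma minors_in_carrier:
  "{minor i j k l | i j k l. i \<in> {1..m} \<and> j \<in> {1..m} \<and> {k, l} \<in> E} \<subseteq> carrier (mpoly_ring (grid m n))"
  using E by (blast intro: minor_in_carrier)

lemma ideal_gen_binomial_edge_ideal: "mpoly_ideal (grid m n) (gen_binomial_edge_ideal m n E)"
  unfolding gen_binomial_edge_ideal_eq
  by (intro mpoly_ideal.intro ring.genideal_ideal minors_in_carrier cring.axioms cring_mpoly_ring)

lemma minor_in_gen_binomial_edge_ideal:
  assumes "i \<in> {1..m}" "j \<in> {1..m}" "{k, l} \<in> E"
  shows "minor i j k l \<in> gen_binomial_edge_ideal m n E"
  unfolding gen_binomial_edge_ideal_eq
  using ring.genideal_self[OF cring.axioms(1)[OF cring_mpoly_ring] minors_in_carrier] assms by blast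

lemma gen_binomial_edge_ideal_minimal:
  assumes "ideal I (mpoly_ring (grid m n))"
    and "\<And>i j k l. i \<in> {1..m} \<Longrightarrow> j \<in> {1..m} \<Longrightarrow> {k, l} \<in> E \<Longrightarrow> minor i j k l \<in> I"
  shows "gen_binomial_edge_ideal m n E \<subseteq> I"
  unfolding gen_binomial_edge_ideal_eq
  using assms by (intro ring.genideal_minimal cring.axioms(1)[OF cring_mpoly_ring]) auto

end

definition avoids :: "nat set \<Rightarrow> (nat \<times> nat \<Rightarrow>\<^sub>0 nat) \<Rightarrow> bool"
  where "avoids T u \<longleftrightarrow> snd ` Poly_Mapping.keys u \<inter> T = {}"

definition kernel_ideal :: "nat \<Rightarrow> nat \<Rightarrow> nat set set \<Rightarrow> nat set \<Rightarrow> (nat \<times> nat, 'k::field) mpoly set"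
  where "kernel_ideal m n E T =
    {p \<in> carrier (mpoly_ring (grid m n)). subst_monomials (avoids T) (profile (comp_name n E T)) p = 0}"

lemma avoids_add: "avoids T (u + v) \<longleftrightarrow> avoids T u \<and> avoids T v"
  by (auto simp: avoids_def keys_add_nat)

lemma avoids_var: "avoids T (var (i, j)) \<longleftrightarrow> j \<notin> T"
  by (simp add: avoids_def)

lemma primeideal_kernel_ideal: "primeideal (kernel_ideal m n E T) (mpoly_ring (grid m n))"
  unfolding kernel_ideal_def
  by (rule primeideal_subst_kernel) (auto simp: avoids_add profile_add, simp add: avoids_def)

lemma ideal_kernel_ideal: "ideal (kernel_ideal m n E T) (mpoly_ring (grid m n))"
  by (rule primeideal.axioms[OF primeideal_kernel_ideal])

lemma kernel_ideal_iff:
  assumes "p \<in> carrier (mpoly_ring (grid m n))" "p \<in> carrier (mpoly_ring (grid m' n))"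
  shows "p \<in> kernel_ideal m n E T \<longleftrightarrow> p \<in> kernel_ideal m' n E T"
  using assms by (simp add: kernel_ideal_def)

lemma minor_in_kernel_ideal:
  assumes "i \<in> {1..m}" "j \<in> {1..m}" "k \<in> {1..n}" "l \<in> {1..n}"
    and "k \<in> T \<or> l \<in> T \<or> comp_name n E T k = comp_name n E T l"
  shows "minor i j k l \<in> kernel_ideal m n E T"
  using assms minor_in_carrier[of i m j k n l]
  by (auto simp: kernel_ideal_def minor_def subst_monomials_diff subst_monomials_single avoids_add
      avoids_var profile_add profile_var ac_simps simp del: One_nat_def)

text \<open>If neither column lies in \<open>T\<close>, the two monomials have equal profiles. Since
  \<open>i \<noteq> j\<close>, the only token of colour \<open>i\<close> is at \<open>k\<close> in
  one and at \<open>l\<close> in the other, so the profiles force these to share a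
  component.\<close>

lemma minor_in_kernel_idealD:
  assumes "minor i j k l \<in> (kernel_ideal m n E T :: (nat \<times> nat, 'k::field) mpoly set)" "i \<noteq> j"
  shows "k \<in> T \<or> l \<in> T \<or> comp_name n E T k = comp_name n E T l"
proof (rule ccontr)
  let ?c = "comp_name n E T"
  assume neg: "\<not> ?thesis"
  then have "mon (profile ?c (var (i, k) + var (j, l))) = (mon (profile ?c (var (i, l) + var (j, k))) :: (_, 'k) mpoly)"
    using assms(1)
    by (simp add: kernel_ideal_def minor_def subst_monomials_diff subst_monomials_single avoids_add
        avoids_var del: One_nat_def)
  then have eq: "profile ?c (var (i, k) + var (j, l)) = profile ?c (var (i, l) + var (j, k))"
    by (metis keys_single singleton_inject zero_neq_one)
  have "prod_encode (Suc i, ?c k) \<in> Poly_Mapping.keys (profile ?c (var (i, k) + var (j, l)))"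
    unfolding row_in_keys_profile_iff by (auto simp: keys_add_nat)
  then have "?c l = ?c k"
    unfolding eq row_in_keys_profile_iff using assms(2) by (auto simp: keys_add_nat)
  with neg show False by simp
qed

lemma var_in_kernel_ideal_iff:
  "i \<in> {1..m} \<Longrightarrow> j \<in> {1..n} \<Longrightarrow> mon (var (i, j)) \<in> kernel_ideal m n E T \<longleftrightarrow> j \<in> T"
  using single_in_carrier[of "var (i, j)" "grid m n" 1]
  by (auto simp: kernel_ideal_def subst_monomials_single avoids_var simp flip: keys_eq_empty simp del: One_nat_def)

section \<open>Generators of \<open>P_cut\<close> and its description as a kernel\<close>

lemma complete_edges_component:
  assumes "C \<in> components_without n E T" "e \<in> complete_edges C"
  shows "e \<subseteq> {1..n}"
  using assms component_same_name(1)[OF assms(1)] by (fastforce simp: complete_edges_def)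

lemma P_cut_generators_in_carrier:
  assumes "T \<subseteq> {1..n}"
  shows "{Var (i, j) | i j. i \<in> {1..m} \<and> j \<in> T} \<union>
    (\<Union>C \<in> components_without n E T. gen_binomial_edge_ideal m n (complete_edges C))
    \<subseteq> carrier (mpoly_ring (grid m n))"
proof -
  have "gen_binomial_edge_ideal m n (complete_edges C) \<subseteq> carrier (mpoly_ring (grid m n))"
    if "C \<in> components_without n E T" for C
    using mpoly_ideal.subset_carrier[OF ideal_gen_binomial_edge_ideal[OF complete_edges_component[OF that]]]
    by blast
  moreover have "Var (i, j) \<in> carrier (mpoly_ring (grid m n))" if "i \<in> {1..m}" "j \<in> T" for i j
    unfolding Var_def using that assms by (intro single_in_carrier) auto
  ultimately show ?thesis by blast
qed

lemma P_cut_minimal: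
  assumes I: "ideal I (mpoly_ring (grid m n))"
    and "\<And>i j. i \<in> {1..m} \<Longrightarrow> j \<in> T \<Longrightarrow> mon (var (i, j)) \<in> I"
    and minor: "\<And>i j k l. i \<in> {1..m} \<Longrightarrow> j \<in> {1..m} \<Longrightarrow> k \<in> {1..n} - T \<Longrightarrow> l \<in> {1..n} - T \<Longrightarrow>
      comp_name n E T k = comp_name n E T l \<Longrightarrow> minor i j k l \<in> I"
  shows "P_cut m n E T \<subseteq> I"
proof -
  have "gen_binomial_edge_ideal m n (complete_edges C) \<subseteq> I" if C: "C \<in> components_without n E T" for C
  proof (rule gen_binomial_edge_ideal_minimal[OF complete_edges_component[OF C] I])
    fix i j k l assume ij: "i \<in> {1..m}" "j \<in> {1..m}" and "{k, l} \<in> complete_edges C"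
    then have "k \<in> C" "l \<in> C" by (auto simp: complete_edges_def doubleton_eq_iff)
    from component_same_name[OF C this] ij show "minor i j k l \<in> I" by (intro minor)
  qed
  with assms(2) show ?thesis
    unfolding P_cut_def Var_def by (intro ring.genideal_minimal[OF cring.axioms(1)[OF cring_mpoly_ring] I]) blast
qed

text \<open>For the harder inclusion: modulo \<open>P_cut\<close>, monomials meeting
  \<open>T\<close> vanish, and tokens at any two vertices of one component may be exchanged, so the
  remaining monomials are determined by their profile.\<close>

lemma P_cut_eq_kernel_ideal:
  assumes T: "T \<subseteq> {1..n}"
  shows "P_cut m n E T = (kernel_ideal m n E T :: (nat \<times> nat, 'k::field) mpoly set)"
proof
  show "P_cut m n E T \<subseteq> (kernel_ideal m n E T :: (nat \<times> nat, 'k) mpoly set)"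
    using T by (intro P_cut_minimal ideal_kernel_ideal minor_in_kernel_ideal)
      (auto simp: var_in_kernel_ideal_iff simp del: One_nat_def)
  let ?P = "P_cut m n E T :: (nat \<times> nat, 'k) mpoly set"
  let ?X = "grid m n" let ?c = "comp_name n E T"
  note gens = P_cut_generators_in_carrier[OF T, of m E]
  have P: "mpoly_ideal ?X ?P"
    unfolding P_cut_def
    by (intro mpoly_ideal.intro ring.genideal_ideal[OF cring.axioms(1)[OF cring_mpoly_ring]] gens)
  interpret P: mpoly_ideal ?X ?P by (rule P)
  note self = ring.genideal_self[OF cring.axioms(1)[OF cring_mpoly_ring] gens, folded P_cut_def]
  have var: "mon (var (i, j)) \<in> ?P" if "i \<in> {1..m}" "j \<in> T" for i j
    using self that unfolding Var_def by blast
  have minor: "minor i j k l \<in> ?P"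
    if ij: "i \<in> {1..m}" "j \<in> {1..m}" and kl: "k \<in> {1..n} - T" "l \<in> {1..n} - T" "?c k = ?c l" for i j k l
  proof (cases "k = l")
    case True
    then show ?thesis by (simp add: minor_def P.zero_in)
  next
    case False
    obtain C where C: "C \<in> components_without n E T" "k \<in> C" "l \<in> C"
      using kl by (rule obtain_component)
    with False have "{k, l} \<in> complete_edges C" by (auto simp: complete_edges_def)
    then have "minor i j k l \<in> gen_binomial_edge_ideal m n (complete_edges C)"
      using ij by (intro minor_in_gen_binomial_edge_ideal complete_edges_component[OF C(1)])
    then show ?thesis using C(1) self by blast
  qed
  show "kernel_ideal m n E T \<subseteq> ?P"
  proof
    fix f :: "(nat \<times> nat, 'k) mpoly" assume f: "f \<in> kernel_ideal m n E T"
    then have fX: "f \<in> carrier (mpoly_ring ?X)"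
      and f0: "subst_monomials (avoids T) (profile ?c) f = 0" by (auto simp: kernel_ideal_def)
    have keys: "Poly_Mapping.keys u \<subseteq> ?X" if "u \<in> Poly_Mapping.keys f" for u
      using fX that by (auto simp: mpoly_ring_simps)
    have bad: "mon u \<in> ?P" if u: "u \<in> Poly_Mapping.keys f" "\<not> avoids T u" for u
    proof -
      obtain i j where ij: "(i, j) \<in> Poly_Mapping.keys u" "j \<in> T" using u(2) by (auto simp: avoids_def)
      then obtain u' where u': "u = var (i, j) + u'" by (metis var_split)
      have "mon u' * mon (var (i, j)) \<in> ?P"
        using keys[OF u(1)] ij by (intro P.single_mult_in var) (auto simp: u' keys_add_nat)
      then show ?thesis by (simp add: u' mult_single add.commute)
    qed
    show "f \<in> ?P"
    proof (rule P.in_ideal_by_classes[OF fX, where \<kappa> = "\<lambda>u. (avoids T u, profile ?c u)"])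
      fix u assume u: "u \<in> Poly_Mapping.keys f"
      \<comment> \<open>If \<open>u\<close> avoids \<open>T\<close>, its class sum is a coefficient
        of the image of \<open>f\<close>, hence \<open>0\<close>.\<close>
      show "mon u \<in> ?P \<or> (\<Sum>v \<in> {v \<in> Poly_Mapping.keys f. (avoids T v, profile ?c v) = (avoids T u, profile ?c u)}.
          Poly_Mapping.lookup f v) = 0"
        using lookup_subst_monomials[of "avoids T" "profile ?c" f "profile ?c u"] bad[OF u]
        by (cases "avoids T u") (simp_all add: f0)
      fix v assume v: "v \<in> Poly_Mapping.keys f" and eq: "(avoids T u, profile ?c u) = (avoids T v, profile ?c v)"
      show "mon u - mon v \<in> ?P"
      proof (cases "avoids T u")
        case True
        have "mon (0 + u) - mon (0 + v) \<in> ?P"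
        proof (rule mon_diff_in_if_profile_eq[OF P refl, where D = "snd ` Poly_Mapping.keys u" and c = ?c])
          fix i j k l and w :: "nat \<times> nat \<Rightarrow>\<^sub>0 nat"
          assume "i \<in> {1..m}" "j \<in> {1..m}" "k \<in> snd ` Poly_Mapping.keys u" "l \<in> snd ` Poly_Mapping.keys u"
            "?c k = ?c l" and w: "Poly_Mapping.keys w \<subseteq> ?X"
          then have "minor i j k l \<in> ?P"
            using keys[OF u] True by (intro minor) (auto simp: avoids_def)
          then show "mon (w + (var (i, k) + var (j, l))) - mon (w + (var (i, l) + var (j, k))) \<in> ?P"
            unfolding minor_def using w by (rule P.mon_diff_shift_in)
        qed (use eq keys u v in auto)
        then show ?thesis by simp
      qed (use eq bad u v in \<open>auto intro: P.diff_in\<close>)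
    qed
  qed
qed

text \<open>From right to left, monomials are grouped by column support and profile; the group of
  \<open>u\<close> is controlled by the kernel for \<open>T = Z u\<close>, the set of columns absent
  from \<open>u\<close>.\<close>

lemma gen_binomial_edge_ideal_iff:
  fixes f :: "(nat \<times> nat, 'k::field) mpoly"
  assumes E: "\<And>e. e \<in> E \<Longrightarrow> e \<subseteq> {1..n}"
  shows "f \<in> gen_binomial_edge_ideal m n E \<longleftrightarrow>
    f \<in> carrier (mpoly_ring (grid m n)) \<and> (\<forall>T \<subseteq> {1..n}. f \<in> kernel_ideal m n E T)"
proof (intro iffI conjI allI impI)
  let ?J = "gen_binomial_edge_ideal m n E :: (nat \<times> nat, 'k) mpoly set" let ?X = "grid m n"
  have J: "mpoly_ideal ?X ?J" using E by (rule ideal_gen_binomial_edge_ideal)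
  then interpret J: mpoly_ideal ?X ?J .
  {
    assume f: "f \<in> ?J"
    show "f \<in> carrier (mpoly_ring ?X)" using f by (rule J.subset_carrier)
    fix T assume T: "T \<subseteq> {1..n}"
    have "?J \<subseteq> kernel_ideal m n E T"
    proof (intro gen_binomial_edge_ideal_minimal E ideal_kernel_ideal minor_in_kernel_ideal)
      fix k l assume kl: "{k, l} \<in> E"
      then show "k \<in> {1..n}" "l \<in> {1..n}" using E by blast+
      then have "(k, l) \<in> comp_rel n E T" if "k \<notin> T" "l \<notin> T"
        using that kl by (auto simp: comp_rel_def adjacency_def induced_edges_def)
      then show "k \<in> T \<or> l \<in> T \<or> comp_name n E T k = comp_name n E T l"
        by (auto simp: comp_name_eq_iff)
    qed
    with f show "f \<in> kernel_ideal m n E T" by blast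
  }
  assume "f \<in> carrier (mpoly_ring ?X) \<and> (\<forall>T \<subseteq> {1..n}. f \<in> kernel_ideal m n E T)"
  then have fX: "f \<in> carrier (mpoly_ring ?X)"
    and f0: "\<And>T. T \<subseteq> {1..n} \<Longrightarrow> subst_monomials (avoids T) (profile (comp_name n E T)) f = 0"
    by (auto simp: kernel_ideal_def)
  define Z where "Z u = {1..n} - snd ` Poly_Mapping.keys u" for u :: "nat \<times> nat \<Rightarrow>\<^sub>0 nat"
  let ?h = "\<lambda>u. profile (comp_name n E (Z u)) u"
  have keys: "Poly_Mapping.keys u \<subseteq> ?X" if "u \<in> Poly_Mapping.keys f" for u
    using fX that by (auto simp: mpoly_ring_simps)
  have cols: "snd ` Poly_Mapping.keys u = {1..n} - Z u" if "u \<in> Poly_Mapping.keys f" for u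
    using keys[OF that] by (force simp: Z_def)
  show "f \<in> ?J"
  proof (rule J.in_ideal_by_classes[OF fX, where \<kappa> = "\<lambda>u. (Z u, ?h u)"])
    fix u assume u: "u \<in> Poly_Mapping.keys f"
    \<comment> \<open>Equal profiles force equal column supports, so the class of \<open>u\<close>
      is one fibre of the substitution for \<open>Z u\<close>.\<close>
    have "(Z v, ?h v) = (Z u, ?h u) \<longleftrightarrow> avoids (Z u) v \<and> profile (comp_name n E (Z u)) v = ?h u" for v
      using columns_eq_if_profile_eq[of "comp_name n E (Z u)" v u] by (auto simp: Z_def avoids_def)
    then show "mon u \<in> ?J \<or> (\<Sum>v \<in> {v \<in> Poly_Mapping.keys f. (Z v, ?h v) = (Z u, ?h u)}. Poly_Mapping.lookup f v) = 0"
      using lookup_subst_monomials[of "avoids (Z u)" "profile (comp_name n E (Z u))" f "?h u"] f0[of "Z u"]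
      by (simp add: Z_def)
    fix v assume v: "v \<in> Poly_Mapping.keys f" and eq: "(Z u, ?h u) = (Z v, ?h v)"
    let ?D = "snd ` Poly_Mapping.keys u" and ?c = "comp_name n E (Z u)"
    have "mon (0 + u) - mon (0 + v) \<in> ?J"
    proof (rule mon_diff_in_if_profile_eq[OF J refl, where D = ?D and c = ?c])
      fix i j k l and w :: "nat \<times> nat \<Rightarrow>\<^sub>0 nat"
      assume ij: "i \<in> {1..m}" "j \<in> {1..m}" and kl: "k \<in> ?D" "l \<in> ?D" "?c k = ?c l"
        and w: "Poly_Mapping.keys w \<subseteq> ?X" "?D \<subseteq> snd ` Poly_Mapping.keys (w + (var (i, k) + var (j, l)))"
      \<comment> \<open>For \<open>T = Z u\<close> the components are those of the graph induced on
        \<open>?D\<close>, so \<open>k\<close> and \<open>l\<close> are joined by a path through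
        vertices that all carry tokens.\<close>
      show "mon (w + (var (i, k) + var (j, l))) - mon (w + (var (i, l) + var (j, k))) \<in> ?J"
      proof (rule swap_along_path[OF J refl, where D = ?D and B = "adjacency (induced_edges E ?D)"])
        show "adjacency (induced_edges E ?D) \<subseteq> ?D \<times> ?D"
          by (auto simp: adjacency_def induced_edges_def)
        show "?D \<subseteq> {1..n}" using cols[OF u] by blast
        show "(k, l) \<in> (adjacency (induced_edges E ?D))\<^sup>*"
          using kl(3) unfolding comp_name_eq_iff comp_rel_def cols[OF u] .
        show "k \<in> {1..n}" using kl(1) cols[OF u] by blast
        fix i j k l assume "i \<in> {1..m}" "j \<in> {1..m}" "(k, l) \<in> adjacency (induced_edges E ?D)"
        then have "minor i j k l \<in> ?J"
          by (intro minor_in_gen_binomial_edge_ideal E) (auto simp: adjacency_def induced_edges_def)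
        then show "mon (var (i, k) + var (j, l)) - mon (var (i, l) + var (j, k)) \<in> ?J"
          by (simp add: minor_def)
      qed (use ij w in auto)
    qed (use eq keys u v in auto)
    then show "mon u - mon v \<in> ?J" by simp
  qed
qed

section \<open>Colon ideals\<close>

lemma mem_colon_iff:
  "g \<in> colon (mpoly_ring X) I f \<longleftrightarrow> g \<in> carrier (mpoly_ring X) \<and> g * f \<in> I"
  by (simp add: colon_def mpoly_ring_simps)

context
  fixes n :: nat and E :: "nat set set"
  assumes E: "\<And>e. e \<in> E \<Longrightarrow> e \<subseteq> {1..n}"
begin

lemma gen_binomial_edge_ideal_subset_kernel_ideal:
  "T \<subseteq> {1..n} \<Longrightarrow> gen_binomial_edge_ideal m n E \<subseteq> kernel_ideal m n E T"
  using gen_binomial_edge_ideal_iff[OF E] by blast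

lemma kernel_ideal_mult_iff:
  assumes "p \<in> carrier (mpoly_ring (grid m n))" "q \<in> carrier (mpoly_ring (grid m n))"
  shows "p * q \<in> kernel_ideal m n E T \<longleftrightarrow> p \<in> kernel_ideal m n E T \<or> q \<in> kernel_ideal m n E T"
proof
  show "p * q \<in> kernel_ideal m n E T \<Longrightarrow> p \<in> kernel_ideal m n E T \<or> q \<in> kernel_ideal m n E T"
    using primeideal.I_prime[OF primeideal_kernel_ideal assms] by (simp add: mpoly_ring_simps(2))
  assume "p \<in> kernel_ideal m n E T \<or> q \<in> kernel_ideal m n E T"
  then show "p * q \<in> kernel_ideal m n E T"
    using ideal.I_l_closed[OF ideal_kernel_ideal _ assms(1)] ideal.I_r_closed[OF ideal_kernel_ideal _ assms(2)]
    by (auto simp: mpoly_ring_simps(2))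
qed

lemma one_notin_kernel_ideal: "1 \<notin> kernel_ideal m n E T"
  using primeideal.I_notcarr[OF primeideal_kernel_ideal[of m n E T]]
    ideal.one_imp_carrier[OF ideal_kernel_ideal[of m n E T]] by (auto simp: mpoly_ring_simps(4))

text \<open>With at least two rows, the inclusion depends on \<open>T\<close> and \<open>T'\<close>
  alone: the variables of row \<open>1\<close> test \<open>T \<subseteq> T'\<close>, and the minors
  of rows \<open>1\<close> and \<open>2\<close> test the components.\<close>

lemma kernel_ideal_subset_mono:
  assumes m: "2 \<le> m" "m \<le> m'" and T: "T \<subseteq> {1..n}"
    and sub: "kernel_ideal m n E T \<subseteq> (kernel_ideal m n E T' :: (nat \<times> nat, 'k::field) mpoly set)"
  shows "kernel_ideal m' n E T \<subseteq> (kernel_ideal m' n E T' :: (nat \<times> nat, 'k) mpoly set)"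
  unfolding P_cut_eq_kernel_ideal[OF T, symmetric]
proof (rule P_cut_minimal[OF ideal_kernel_ideal])
  fix i j assume i: "i \<in> {1..m'}" and j: "j \<in> T"
  have jn: "j \<in> {1..n}" and m1: "1 \<in> {1..m}" using T m j by auto
  have "(mon (var (1, j)) :: (nat \<times> nat, 'k) mpoly) \<in> kernel_ideal m n E T'"
    using j by (intro subsetD[OF sub]) (simp only: var_in_kernel_ideal_iff[OF m1 jn])
  then show "mon (var (i, j)) \<in> kernel_ideal m' n E T'"
    by (simp only: var_in_kernel_ideal_iff[OF m1 jn] var_in_kernel_ideal_iff[OF i jn])
next
  fix i j k l
  assume "i \<in> {1..m'}" "j \<in> {1..m'}" and kl: "k \<in> {1..n} - T" "l \<in> {1..n} - T"
    "comp_name n E T k = comp_name n E T l"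
  moreover have "(minor 1 2 k l :: (nat \<times> nat, 'k) mpoly) \<in> kernel_ideal m n E T'"
    using m kl by (intro subsetD[OF sub] minor_in_kernel_ideal) auto
  then have "k \<in> T' \<or> l \<in> T' \<or> comp_name n E T' k = comp_name n E T' l"
    by (rule minor_in_kernel_idealD) simp
  ultimately show "minor i j k l \<in> kernel_ideal m' n E T'"
    by (intro minor_in_kernel_ideal) auto
qed

lemma colon_eq_kernel_ideal_mono:
  fixes f :: "(nat \<times> nat, 'k::field) mpoly"
  assumes m: "2 \<le> m" "m \<le> m'" and T: "T \<subseteq> {1..n}" and f: "f \<in> carrier (mpoly_ring (grid m n))"
    and colon: "colon (mpoly_ring (grid m n)) (gen_binomial_edge_ideal m n E) f = kernel_ideal m n E T"
  shows "colon (mpoly_ring (grid m' n)) (gen_binomial_edge_ideal m' n E) f = kernel_ideal m' n E T"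
proof -
  have "grid m n \<subseteq> grid m' n" using m by auto
  then have f': "f \<in> carrier (mpoly_ring (grid m' n))" using f carrier_mpoly_ring_mono by blast
  note f_iff = kernel_ideal_iff[OF f f', where E = E]
  \<comment> \<open>If \<open>g * f\<close> lies in the prime \<open>kernel_ideal m n E T'\<close>
    and \<open>f\<close> does not, then \<open>g\<close> does.\<close>
  have sub: "kernel_ideal m n E T \<subseteq> (kernel_ideal m n E T' :: (nat \<times> nat, 'k) mpoly set)"
    if T': "T' \<subseteq> {1..n}" "f \<notin> kernel_ideal m n E T'" for T'
  proof
    fix g :: "(nat \<times> nat, 'k) mpoly" assume "g \<in> kernel_ideal m n E T"
    then have "g \<in> carrier (mpoly_ring (grid m n))" "g * f \<in> gen_binomial_edge_ideal m n E"
      by (simp_all add: colon[symmetric] mem_colon_iff)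
    then show "g \<in> kernel_ideal m n E T'"
      using gen_binomial_edge_ideal_subset_kernel_ideal[OF T'(1)] f T'(2) kernel_ideal_mult_iff by blast
  qed
  \<comment> \<open>Otherwise \<open>f\<close> lies in every kernel: by \<open>sub\<close>, a kernel
    without \<open>f\<close> would contain the one for \<open>T\<close>, hence \<open>f\<close>.
    Then \<open>f\<close> is in the edge ideal and the colon ideal contains
    \<open>1\<close>.\<close>
  have fT: "f \<notin> kernel_ideal m n E T"
  proof
    assume "f \<in> kernel_ideal m n E T"
    with sub have "f \<in> gen_binomial_edge_ideal m n E"
      using f by (auto simp: gen_binomial_edge_ideal_iff[OF E])
    then have "1 \<in> colon (mpoly_ring (grid m n)) (gen_binomial_edge_ideal m n E) f"
      using single_in_carrier[of 0 "grid m n" "1::'k"] by (simp add: mem_colon_iff)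
    then show False using one_notin_kernel_ideal unfolding colon by blast
  qed
  show ?thesis
  proof (intro equalityI subsetI)
    fix g :: "(nat \<times> nat, 'k) mpoly"
    assume "g \<in> colon (mpoly_ring (grid m' n)) (gen_binomial_edge_ideal m' n E) f"
    then have "g \<in> carrier (mpoly_ring (grid m' n))" "g * f \<in> kernel_ideal m' n E T"
      using gen_binomial_edge_ideal_subset_kernel_ideal[OF T] by (auto simp: mem_colon_iff)
    then show "g \<in> kernel_ideal m' n E T"
      using fT f' f_iff kernel_ideal_mult_iff by blast
  next
    fix g :: "(nat \<times> nat, 'k) mpoly"
    assume g: "g \<in> kernel_ideal m' n E T"
    then have gX: "g \<in> carrier (mpoly_ring (grid m' n))" by (simp add: kernel_ideal_def)
    \<comment> \<open>Either \<open>f\<close> lies in the kernel for \<open>T'\<close>, for both row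
      numbers, or the inclusion \<open>sub\<close> carries over to \<open>m'\<close> and places
      \<open>g\<close> there.\<close>
    have gf: "g * f \<in> kernel_ideal m' n E T'" if "T' \<subseteq> {1..n}" for T'
      using sub[OF that] kernel_ideal_subset_mono[OF m T, of T'] g
      by (auto simp: kernel_ideal_mult_iff[OF gX f'] f_iff[symmetric])
    moreover have "g * f \<in> carrier (mpoly_ring (grid m' n))"
      using gf[of "{}"] by (simp add: kernel_ideal_def)
    ultimately show "g \<in> colon (mpoly_ring (grid m' n)) (gen_binomial_edge_ideal m' n E) f"
      using gX by (simp add: mem_colon_iff gen_binomial_edge_ideal_iff[OF E])
  qed
qed

text \<open>If no kernel without \<open>f\<close> were inside \<open>P\<close>, choosing from each
  an element outside \<open>P\<close> would give a product outside \<open>P\<close> that multiplies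
  \<open>f\<close> into every kernel, hence into the edge ideal. That contradicts
  \<open>colon\<close>.\<close>

lemma prime_colon_eq_kernel_ideal:
  fixes f :: "(nat \<times> nat, 'k::field) mpoly"
  assumes P: "primeideal P (mpoly_ring (grid m n))" and f: "f \<in> carrier (mpoly_ring (grid m n))"
    and colon: "colon (mpoly_ring (grid m n)) (gen_binomial_edge_ideal m n E) f = P"
  obtains T where "T \<subseteq> {1..n}" "P = kernel_ideal m n E T"
proof -
  let ?R = "mpoly_ring (grid m n) :: (nat \<times> nat, 'k) mpoly ring"
  let ?V = "\<lambda>T. kernel_ideal m n E T :: (nat \<times> nat, 'k) mpoly set"
  interpret P: primeideal P ?R by (rule P)
  define S where "S = {T. T \<subseteq> {1..n} \<and> f \<notin> ?V T}"
  have S: "finite S" by (simp add: S_def)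
  have "\<exists>T \<in> S. ?V T \<subseteq> P"
  proof (rule ccontr)
    assume "\<not> ?thesis"
    then have "\<forall>T \<in> S. \<exists>h. h \<in> ?V T - P" by blast
    from bchoice[OF this] obtain g where g: "\<And>T. T \<in> S \<Longrightarrow> g T \<in> ?V T - P" by blast
    then have gX: "g T \<in> carrier ?R" if "T \<in> S" for T using that by (auto simp: kernel_ideal_def)
    have "prod g A \<in> carrier ?R - P \<and> (\<forall>T \<in> A. prod g A \<in> ?V T)" if "finite A" "A \<subseteq> S" for A
      using that
    proof (induction A)
      case empty
      then show ?case using P.one_closed P.one_imp_carrier P.I_notcarr by (auto simp: mpoly_ring_simps(4))
    next
      case (insert T A)
      then show ?case
        using g[of T] gX[of T] P.m_closed[of "g T" "prod g A"] P.I_prime[of "g T" "prod g A"]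
        by (auto simp: kernel_ideal_mult_iff mpoly_ring_simps(2))
    qed
    from this[OF S subset_refl] have g: "prod g S \<in> carrier ?R" "prod g S \<notin> P" "\<And>T. T \<in> S \<Longrightarrow> prod g S \<in> ?V T"
      by auto
    have "prod g S * f \<in> ?V T" if "T \<subseteq> {1..n}" for T
    proof (cases "T \<in> S")
      case False
      then have "f \<in> ?V T" using that by (simp add: S_def)
      then show ?thesis by (simp add: kernel_ideal_mult_iff[OF g(1) f])
    qed (simp add: g(3) kernel_ideal_mult_iff[OF g(1) f])
    moreover have "prod g S * f \<in> carrier ?R" using P.m_closed[OF g(1) f] by (simp add: mpoly_ring_simps(2))
    ultimately show False
      using g(1,2) by (simp add: colon[symmetric] mem_colon_iff gen_binomial_edge_ideal_iff[OF E])
  qed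
  then obtain T where T: "T \<subseteq> {1..n}" "f \<notin> ?V T" "?V T \<subseteq> P" by (auto simp: S_def)
  \<comment> \<open>Every \<open>g\<close> in \<open>P\<close> has \<open>g * f\<close> in the prime
    \<open>?V T\<close>, which does not contain \<open>f\<close>.\<close>
  have "P \<subseteq> ?V T"
  proof
    fix g assume "g \<in> P"
    then have "g \<in> carrier ?R" "g * f \<in> ?V T"
      using gen_binomial_edge_ideal_subset_kernel_ideal[OF T(1)] by (auto simp: colon[symmetric] mem_colon_iff)
    then show "g \<in> ?V T" using f T(2) kernel_ideal_mult_iff by blast
  qed
  with T that show thesis by blast
qed

section \<open>Monotonicity of the v-numbers\<close>

lemma v_cut_J_antimono:
  assumes m: "2 \<le> m" "m \<le> m'" and T: "T \<subseteq> {1..n}"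
  shows "v_cut_J TYPE('k::field) m' n E T \<le> v_cut_J TYPE('k) m n E T"
proof -
  have "grid m n \<subseteq> grid m' n" using m by auto
  note mono = carrier_mpoly_ring_mono[OF this]
  show ?thesis
    \<comment> \<open>The same \<open>f\<close> of the same degree serves for \<open>m'\<close>, so
      the set of degrees only grows with the number of rows.\<close>
    unfolding v_cut_J_def v_local_def P_cut_eq_kernel_ideal[OF T] graded_component_def
    using colon_eq_kernel_ideal_mono[OF m T] mono by (intro Inf_superset_mono) blast
qed

text \<open>Each associated prime for \<open>m\<close> is the kernel of some \<open>T\<close>. The
  element \<open>f\<close> that realizes it also makes the kernel of \<open>T\<close> for
  \<open>m'\<close> associated, and the local inequality for this \<open>T\<close> applies.\<close>

lemma v_J_antimono:
  assumes m: "2 \<le> m" "m \<le> m'"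
  shows "v_J TYPE('k::field) m' n E \<le> v_J TYPE('k) m n E"
  unfolding v_J_def v_number_def
proof (rule INF_greatest)
  let ?X = "grid m n" let ?J = "\<lambda>m. gen_binomial_edge_ideal m n E :: (nat \<times> nat, 'k) mpoly set"
  fix P :: "(nat \<times> nat, 'k) mpoly set" assume "P \<in> Ass (mpoly_ring ?X) (?J m)"
  then obtain f where f: "primeideal P (mpoly_ring ?X)" "f \<in> carrier (mpoly_ring ?X)"
    "colon (mpoly_ring ?X) (?J m) f = P" by (auto simp: Ass_def)
  obtain T where T: "T \<subseteq> {1..n}" "P = kernel_ideal m n E T"
    using f by (rule prime_colon_eq_kernel_ideal)
  have "grid m n \<subseteq> grid m' n" using m by auto
  then have f': "f \<in> carrier (mpoly_ring (grid m' n))" using f(2) carrier_mpoly_ring_mono by blast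
  have "colon (mpoly_ring (grid m' n)) (?J m') f = kernel_ideal m' n E T"
    using m T(1) f(2) f(3)[unfolded T(2)] by (rule colon_eq_kernel_ideal_mono)
  then have "kernel_ideal m' n E T \<in> Ass (mpoly_ring (grid m' n)) (?J m')"
    using f' primeideal_kernel_ideal by (auto simp: Ass_def)
  then have "(INF P \<in> Ass (mpoly_ring (grid m' n)) (?J m'). v_local (grid m' n) P (?J m'))
      \<le> v_local (grid m' n) (kernel_ideal m' n E T) (?J m')"
    by (rule INF_lower)
  also have "\<dots> \<le> v_local ?X P (?J m)"
    using v_cut_J_antimono[OF m T(1), where 'k = 'k] by (simp add: v_cut_J_def P_cut_eq_kernel_ideal[OF T(1)] T(2))
  finally show "(INF P \<in> Ass (mpoly_ring (grid m' n)) (?J m'). v_local (grid m' n) P (?J m'))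
      \<le> v_local ?X P (?J m)" .
qed

end

theorem theorem9p3:
  fixes n :: nat and E :: "nat set set"
  assumes "n \<ge> 2"
    and "simple_graph {1..n} E"
    and "connected_graph {1..n} E"
  shows "(\<forall>T m1 m2. cut_set n E T \<and> 2 \<le> m1 \<and> m1 \<le> m2 \<longrightarrow>
            v_cut_J TYPE('k::field) m2 n E T \<le> v_cut_J TYPE('k) m1 n E T) \<and>
         (\<forall>T m. cut_set n E T \<and> 2 \<le> m \<longrightarrow>
            v_cut_J TYPE('k) (m + 1) n E T \<le> v_cut_J TYPE('k) m n E T) \<and>
         (\<forall>m. 2 \<le> m \<longrightarrow> v_J TYPE('k) (m + 1) n E \<le> v_J TYPE('k) m n E)"
proof -
  have E: "e \<subseteq> {1..n}" if "e \<in> E" for e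
    using assms(2) that by (simp add: simple_graph_def)
  note v_cut = v_cut_J_antimono[OF E] and v = v_J_antimono[OF E]
  show ?thesis
    by (intro conjI allI impI; (rule v_cut | rule v)) (simp_all add: cut_set_def)
qed

end
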